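(* For $a\in\mathbb{D}$, the eigenspaces of $C_a$ are $$N(C_a-I)=\Big\{f=\sum_{n=0}^\infty \alpha_n(\varphi_{\omega_a})^{2n}: (\alpha_n)\in\ell^2\Big\}=C_{\omega_a}(\mathcal{E})$$ and $$N(C_a+I)=\Big\{g=\sum_{n=0}^\infty \alpha_n(\varphi_{\omega_a})^{2n+1}: (\alpha_n)\in\ell^2\Big\}=C_{\omega_a}(\mathcal{O}).$$
   Context: $\mathbb{D}$ is the open unit disk and $H^2=H^2(\mathbb{D})$ the Hardy space. For $a\in\mathbb{D}$, $\varphi_a(z)=\frac{a-z}{1-\bar a z}$ and $C_a:H^2\to H^2$, $C_af=f\circ\varphi_a$, is bounded with $C_a^2=I$. $N(\cdot)$ is the nullspace. $\omega_a$ is the unique fixed point of $\varphi_a$ in $\mathbb{D}$: $\omega_a=\frac{1}{\bar a}\{1-\sqrt{1-|a|^2}\}$ if $a\ne0$, and $\omega_0=0$; $C_{\omega_a}$ is the operator $f\mapsto f\circ\varphi_{\omega_a}$. $\mathcal{E}$ and $\mathcal{O}$ are the closed subspaces of even and odd functions in $H^2$. Powers $(\varphi_{\omega_a})^{k}$ are pointwise powers. *)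

theory Defs
  imports "HOL-Complex_Analysis.Complex_Analysis"
begin

text \<open>
  Functions on the open unit disk are represented by total functions that vanish outside it, so
  that equality of functions on the disk is HOL equality.
\<close>

definition on_disk :: "(complex \<Rightarrow> complex) \<Rightarrow> complex \<Rightarrow> complex" where
  "on_disk f = (\<lambda>z. if z \<in> ball 0 1 then f z else 0)"

definition ell2 :: "(nat \<Rightarrow> complex) set" where
  "ell2 = {\<alpha>. summable (\<lambda>n. (cmod (\<alpha> n))\<^sup>2)}"

text \<open>
  The Hardy space: holomorphic functions on the disk with square-summable Taylor coefficients,
  normed by the \<open>\<ell>\<^sup>2\<close> norm of the coefficients.
\<close>

definition hardy :: "(complex \<Rightarrow> complex) set" where
  "hardy = {f. f holomorphic_on ball 0 1 \<and> (\<forall>z. z \<notin> ball 0 1 \<longrightarrow> f z = 0) \<and>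
               fps_nth (fps_expansion f 0) \<in> ell2}"

definition hardy_norm :: "(complex \<Rightarrow> complex) \<Rightarrow> real" where
  "hardy_norm f = sqrt (\<Sum>n. (cmod (fps_nth (fps_expansion f 0) n))\<^sup>2)"

text \<open>\<open>f = (\<Sum>n. g n)\<close>, with convergence in the norm of the Hardy space.\<close>

definition hardy_sums :: "(nat \<Rightarrow> complex \<Rightarrow> complex) \<Rightarrow> (complex \<Rightarrow> complex) \<Rightarrow> bool" where
  "hardy_sums g f \<longleftrightarrow> (\<forall>n. g n \<in> hardy) \<and> f \<in> hardy \<and>
     (\<lambda>N. hardy_norm (\<lambda>z. f z - (\<Sum>n<N. g n z))) \<longlonglongrightarrow> 0"

definition even_hardy :: "(complex \<Rightarrow> complex) set" where
  "even_hardy = {f \<in> hardy. \<forall>z \<in> ball 0 1. f (- z) = f z}"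

definition odd_hardy :: "(complex \<Rightarrow> complex) set" where
  "odd_hardy = {f \<in> hardy. \<forall>z \<in> ball 0 1. f (- z) = - f z}"

definition disk_aut :: "complex \<Rightarrow> complex \<Rightarrow> complex" where
  "disk_aut a z = (a - z) / (1 - cnj a * z)"

definition comp_op :: "complex \<Rightarrow> (complex \<Rightarrow> complex) \<Rightarrow> complex \<Rightarrow> complex" where
  "comp_op a f = on_disk (f \<circ> disk_aut a)"

definition nullspace :: "((complex \<Rightarrow> complex) \<Rightarrow> complex \<Rightarrow> complex) \<Rightarrow> (complex \<Rightarrow> complex) set" where
  "nullspace T = {f \<in> hardy. T f = (\<lambda>z. 0)}"

definition fix_pt :: "complex \<Rightarrow> complex" where
  "fix_pt a = (if a = 0 then 0 else 1 / cnj a * (1 - of_real (sqrt (1 - (cmod a)\<^sup>2))))"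

lemma fix_pt_eq:
  assumes "cmod a < 1"
  shows "fix_pt a = a / (1 + of_real (sqrt (1 - (cmod a)\<^sup>2)))"
proof (cases "a = 0")
  case False
  define s where "s = sqrt (1 - (cmod a)\<^sup>2)"
  have s0: "s \<ge> 0" and s2: "s\<^sup>2 = 1 - (cmod a)\<^sup>2"
    using assms by (auto simp: s_def power_le_one)
  have "(1 - complex_of_real s) * (1 + complex_of_real s) = of_real (1 - s\<^sup>2)"
    by (simp add: algebra_simps power2_eq_square)
  also have "\<dots> = a * cnj a"
    by (simp add: s2 flip: complex_norm_square)
  finally have eq: "(1 - complex_of_real s) * (1 + complex_of_real s) = a * cnj a" .
  have "complex_of_real (1 + s) \<noteq> 0"
    using s0 unfolding of_real_eq_0_iff by linarith
  then have "1 + complex_of_real s \<noteq> 0"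
    by simp
  then show ?thesis
    using eq False by (simp add: fix_pt_def s_def [symmetric] field_simps)
qed (simp add: fix_pt_def)

lemma disk_aut_fixed_iff:
  assumes "cmod a < 1" "cmod w < 1"
  shows "disk_aut a w = w \<longleftrightarrow> cnj a * w\<^sup>2 - 2 * w + a = 0"
proof -
  have "cmod (cnj a * w) < 1"
    using assms mult_strict_mono' [of "cmod a" 1 "cmod w" 1] by (simp add: norm_mult)
  then have "1 - cnj a * w \<noteq> 0"
    by auto
  then show ?thesis
    by (auto simp: disk_aut_def field_simps power2_eq_square)
qed

lemma fix_pt_unique_fixed_point:
  assumes "cmod a < 1"
  shows "w \<in> ball 0 1 \<and> disk_aut a w = w \<longleftrightarrow> w = fix_pt a"
proof -
  define s where "s = sqrt (1 - (cmod a)\<^sup>2)"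
  have s0: "s \<ge> 0"
    using assms by (auto simp: s_def power_le_one)
  have "cmod (1 + complex_of_real s) = 1 + s"
    using s0 by (metis norm_of_real of_real_1 of_real_add abs_of_nonneg add_nonneg_nonneg zero_le_one)
  then have v1: "cmod (fix_pt a) < 1"
    using assms s0 by (simp add: fix_pt_eq s_def [symmetric] norm_divide field_simps)
  have vq: "cnj a * (fix_pt a)\<^sup>2 - 2 * fix_pt a + a = 0"
  proof (cases "a = 0")
    case False
    have "(complex_of_real s)\<^sup>2 = of_real (1 - (cmod a)\<^sup>2)"
      using assms by (auto simp: s_def power_le_one simp flip: of_real_power)
    then have "(complex_of_real s)\<^sup>2 = 1 - a * cnj a"
      by (simp flip: complex_norm_square)
    then have "(1 - complex_of_real s)\<^sup>2 - 2 * (1 - complex_of_real s) + a * cnj a = 0"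
      by (simp add: power2_diff)
    moreover have "cnj a * (fix_pt a)\<^sup>2 - 2 * fix_pt a + a =
        ((1 - complex_of_real s)\<^sup>2 - 2 * (1 - complex_of_real s) + a * cnj a) / cnj a"
      if "fix_pt a = (1 - complex_of_real s) / cnj a"
      using False unfolding that by (simp add: field_simps power2_eq_square)
    moreover have "fix_pt a = (1 - complex_of_real s) / cnj a"
      using False by (simp add: fix_pt_def s_def)
    ultimately show ?thesis
      by simp
  qed (simp add: fix_pt_def)
  have "w = fix_pt a" if w: "cmod w < 1" "cnj a * w\<^sup>2 - 2 * w + a = 0"
  proof (rule ccontr)
    assume ne: "w \<noteq> fix_pt a"
    have "(w - fix_pt a) * (cnj a * (w + fix_pt a) - 2) = 0"
      using w(2) vq by algebra
    with ne have "cnj a * (w + fix_pt a) = 2"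
      by simp
    then have "cmod a * cmod (w + fix_pt a) = 2"
      by (metis complex_mod_cnj norm_mult norm_numeral)
    moreover have "cmod a * cmod (w + fix_pt a) \<le> 1 * cmod (w + fix_pt a)"
      using assms by (intro mult_right_mono) auto
    moreover have "cmod (w + fix_pt a) < 2"
      using w(1) v1 norm_triangle_ineq [of w "fix_pt a"] by linarith
    ultimately show False
      by linarith
  qed
  then show ?thesis
    using disk_aut_fixed_iff [OF assms] v1 vq by auto
qed

end

theory Submission
  imports Defs
begin

text \<open>
  Put \<open>w = fix_pt a\<close>. The involution \<open>disk_aut w\<close> carries the fixed point of \<open>disk_aut a\<close> to the
  origin, so it conjugates \<open>disk_aut a\<close> to an involutive automorphism of the disk fixing the origin,
  which is \<open>z \<mapsto> - z\<close> (\<open>disk_aut_fix_pt_conjugation\<close>). Hence \<open>f\<close> is an eigenfunction of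
  \<open>comp_op a\<close> with eigenvalue \<open>1\<close> or \<open>- 1\<close> exactly when \<open>comp_op w f\<close> is even or odd, and, \<open>comp_op w\<close>
  being its own inverse, the eigenspaces are the images under \<open>comp_op w\<close> of the even and the odd
  functions (\<open>eigenspace_eq_comp_op_image\<close>). Even and odd functions are those whose Taylor series
  live on the exponents \<open>2 n\<close> and \<open>2 n + 1\<close>; such a series converges in the Hardy space, and
  \<open>comp_op w\<close> turns it into the series in powers of \<open>disk_aut w\<close>
  (\<open>series_space_eq_comp_op_image\<close>).

  The analytic content is that \<open>comp_op w\<close> is bounded on the Hardy space (\<open>comp_op_bounded\<close>). With
  \<open>s\<^sup>2 = 1 - \<bar>w\<bar>\<^sup>2\<close> and the normalised Szego kernel \<open>k(z) = s / (1 - cnj w * z)\<close>, the weighted operator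
  \<open>f \<mapsto> k * (f \<circ> disk_aut w)\<close> is an isometry: up to sign, it sends \<open>z\<^sup>n\<close> to the \<open>n\<close>-th function of the
  Takenaka-Malmquist orthonormal system with all zeros at \<open>w\<close>. That it is contractive on polynomials
  follows by peeling off one coefficient at a time, each step resting on an exact identity between
  finite sums of squared coefficients (\<open>energy_identity\<close>). Removing the weight costs
  a constant factor, and arbitrary functions are reached by passing to the limit in each
  Taylor coefficient.
\<close>

section \<open>Composition with a disk automorphism on polynomials\<close>

abbreviation coef :: "(complex \<Rightarrow> complex) \<Rightarrow> nat \<Rightarrow> complex" where
  "coef f \<equiv> fps_nth (fps_expansion f 0)"

definition szego_fps :: "complex \<Rightarrow> complex fps" where
  "szego_fps w = Abs_fps (\<lambda>n. cnj w ^ n)"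

definition disk_aut_fps :: "complex \<Rightarrow> complex fps" where
  "disk_aut_fps w = (fps_const w - fps_X) * szego_fps w"

lemma szego_fps_inverse: "(1 - fps_const (cnj w) * fps_X) * szego_fps w = 1"
proof (rule fps_ext)
  fix n
  show "fps_nth ((1 - fps_const (cnj w) * fps_X) * szego_fps w) n = fps_nth 1 n"
    by (cases n) (simp_all add: szego_fps_def ring_distribs mult.assoc)
qed

text \<open>
  The matrix \<open>U\<close> with rows \<open>(s, w)\<close> and \<open>(cnj w, - s)\<close> is unitary, so \<open>U (d, x) - (y, 0)\<close> is as long as
  \<open>(d, x) - U\<^sup>* (y, 0)\<close>. This moves the remainder term of \<open>energy_identity\<close> from one index to the next.
\<close>

lemma cmod_rotation_identity:
  fixes d w x y :: complex and s :: real
  assumes "s\<^sup>2 = 1 - (cmod w)\<^sup>2"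
  shows "(cmod (d * s + (w * x - y)))\<^sup>2 + (cmod (d * cnj w - s * x))\<^sup>2 =
         (cmod (x - cnj w * y))\<^sup>2 + (cmod (d - s * y))\<^sup>2"
proof -
  have s: "s * s = 1 - Re w * Re w - Im w * Im w"
    using assms by (simp add: cmod_power2) (simp add: power2_eq_square)
  show ?thesis
    unfolding cmod_power2 using s by (simp add: power2_eq_square) algebra
qed

text \<open>
  Let \<open>K\<close> be the coefficient sequence of \<open>G / (1 - cnj w * z)\<close>. The sum on the left then runs over the
  coefficients of \<open>c * k + disk_aut w * G\<close>, with \<open>k\<close> the normalised Szego kernel, and the sum on the
  right over those of \<open>G\<close>. In the limit this is the Pythagorean theorem: \<open>k\<close> is a unit vector,
  multiplication by \<open>disk_aut w\<close> is isometric, and \<open>k\<close> is orthogonal to multiples of \<open>disk_aut w\<close>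
  because these vanish at \<open>w\<close>. Truncated at \<open>N\<close>, the only error is one square of definite sign, so the
  inequality drawn from it holds for every formal power series \<open>G\<close>.
\<close>

lemma energy_identity:
  fixes c w :: complex and s :: real and K :: "nat \<Rightarrow> complex"
  assumes "s\<^sup>2 = 1 - (cmod w)\<^sup>2"
  defines "P \<equiv> \<lambda>n. if n = 0 then 0 else K (n - 1)"
  shows "(\<Sum>n\<le>N. (cmod (c * s * cnj w ^ n + (w * K n - P n)))\<^sup>2) + 
           (cmod (c * cnj w ^ Suc N - s * K N))\<^sup>2 =
         (cmod c)\<^sup>2 + (\<Sum>n\<le>N. (cmod (K n - cnj w * P n))\<^sup>2)"
proof (induction N)
  case 0
  show ?case
    using cmod_rotation_identity [OF assms(1), of c "K 0" 0] by (simp add: P_def)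
next
  case (Suc N)
  have "(cmod (c * s * cnj w ^ Suc N + (w * K (Suc N) - P (Suc N))))\<^sup>2 +
          (cmod (c * cnj w ^ Suc (Suc N) - s * K (Suc N)))\<^sup>2 =
        (cmod (K (Suc N) - cnj w * P (Suc N)))\<^sup>2 + (cmod (c * cnj w ^ Suc N - s * K N))\<^sup>2"
    using cmod_rotation_identity [OF assms(1), of "c * cnj w ^ Suc N" "K (Suc N)" "K N"]
    by (simp add: P_def mult_ac)
  with Suc show ?case
    by simp
qed

lemma energy_step:
  fixes w c :: complex and s :: real
  assumes "s\<^sup>2 = 1 - (cmod w)\<^sup>2"
  shows "(\<Sum>n\<le>N. (cmod (fps_nth (fps_const (c * s) * szego_fps w + disk_aut_fps w * G) n))\<^sup>2)
         \<le> (cmod c)\<^sup>2 + (\<Sum>n\<le>N. (cmod (fps_nth G n))\<^sup>2)"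
proof -
  define K where "K = szego_fps w * G"
  define P where "P = (\<lambda>n. if n = 0 then 0 else fps_nth K (n - 1))"
  have "G = (1 - fps_const (cnj w) * fps_X) * K"
    by (simp add: K_def szego_fps_inverse flip: mult.assoc)
  then have G: "fps_nth G n = fps_nth K n - cnj w * P n" for n
    by (cases n) (simp_all add: P_def ring_distribs mult.assoc)
  have "fps_const (c * s) * szego_fps w + disk_aut_fps w * G =
      fps_const (c * s) * szego_fps w + (fps_const w * K - fps_X * K)"
    by (simp add: K_def disk_aut_fps_def ring_distribs mult.assoc left_diff_distrib)
  then have H: "fps_nth (fps_const (c * s) * szego_fps w + disk_aut_fps w * G) n =
      c * s * cnj w ^ n + (w * fps_nth K n - P n)" for n
    by (cases n) (simp_all add: P_def szego_fps_def)
  show ?thesis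
    using energy_identity [OF assms, where N = N and c = c and K = "fps_nth K"] unfolding G H P_def
    by (smt (verit) zero_le_power2)
qed

text \<open>
  The image of \<open>c\<^sub>0 + z * p(z)\<close> under the weighted operator is \<open>c\<^sub>0\<close> times the kernel plus
  \<open>disk_aut w\<close> times the image of \<open>p\<close>, which is the shape that \<open>energy_step\<close> handles.
\<close>

lemma weighted_composition_contractive:
  fixes w :: complex and s :: real and c :: "nat \<Rightarrow> complex"
  assumes "s\<^sup>2 = 1 - (cmod w)\<^sup>2"
  shows "(\<Sum>j\<le>N. (cmod (fps_nth (fps_const (of_real s) * szego_fps w *
           (\<Sum>i<n. fps_const (c i) * disk_aut_fps w ^ i)) j))\<^sup>2) \<le> (\<Sum>i<n. (cmod (c i))\<^sup>2)"
proof (induction n arbitrary: c)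
  case (Suc n)
  define G where "G = fps_const (of_real s) * szego_fps w *
    (\<Sum>i<n. fps_const (c (Suc i)) * disk_aut_fps w ^ i)"
  have "fps_const (of_real s) * szego_fps w * (\<Sum>i<Suc n. fps_const (c i) * disk_aut_fps w ^ i) =
      fps_const (c 0 * s) * szego_fps w + disk_aut_fps w * G"
    by (simp add: G_def sum.lessThan_Suc_shift sum_distrib_left distrib_left mult_ac
        del: sum.lessThan_Suc flip: fps_const_mult)
  then show ?case
    using energy_step [OF assms, where N = N and c = "c 0" and G = G] Suc [of "\<lambda>i. c (Suc i)"]
    by (simp add: G_def sum.lessThan_Suc_shift del: sum.lessThan_Suc)
qed simp

lemma cmod_diff_squared_le: "(cmod (x - y))\<^sup>2 \<le> 2 * (cmod x)\<^sup>2 + 2 * (cmod y)\<^sup>2"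
proof -
  have "(cmod (x - y))\<^sup>2 + (cmod (x + y))\<^sup>2 = 2 * (cmod x)\<^sup>2 + 2 * (cmod y)\<^sup>2"
    unfolding cmod_power2 by (simp add: power2_eq_square algebra_simps)
  then show ?thesis
    by (smt (verit) zero_le_power2)
qed

text \<open>
  The weight is removed by multiplying with \<open>(1 - cnj w * z) / s\<close>. Since \<open>\<bar>w\<bar> < 1\<close>, this multiplies sums
  of squared coefficients by at most \<open>4 / s\<^sup>2\<close>.
\<close>

lemma polynomial_composition_bound:
  fixes w :: complex and c :: "nat \<Rightarrow> complex"
  assumes "cmod w < 1"
  shows "(\<Sum>j\<le>N. (cmod (fps_nth (\<Sum>i<n. fps_const (c i) * disk_aut_fps w ^ i) j))\<^sup>2)
         \<le> 4 / (1 - (cmod w)\<^sup>2) * (\<Sum>i<n. (cmod (c i))\<^sup>2)"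
proof -
  define s where "s = sqrt (1 - (cmod w)\<^sup>2)"
  have s2: "s\<^sup>2 = 1 - (cmod w)\<^sup>2" and s0: "s > 0"
    using assms by (auto simp: s_def power_le_one power_less_one_iff abs_square_less_1)
  define Q where "Q = (\<Sum>i<n. fps_const (c i) * disk_aut_fps w ^ i)"
  \<comment> \<open>The image of the polynomial under the weighted operator.\<close>
  define U where "U = fps_const (of_real s) * szego_fps w * Q"
  have "(1 - fps_const (cnj w) * fps_X) * U =
      fps_const (of_real s) * (((1 - fps_const (cnj w) * fps_X) * szego_fps w) * Q)"
    by (simp add: U_def mult_ac)
  then have QU: "fps_const (of_real s) * Q = (1 - fps_const (cnj w) * fps_X) * U"
    by (simp add: szego_fps_inverse)
  define P where "P = (\<lambda>n. if n = 0 then 0 else fps_nth U (n - 1))"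
  have sQ: "of_real s * fps_nth Q j = fps_nth U j - cnj w * P j" for j
    using arg_cong [OF QU, of "\<lambda>F. fps_nth F j"]
    by (cases j) (simp_all add: P_def ring_distribs mult.assoc)
  have P: "(\<Sum>j\<le>N. (cmod (P j))\<^sup>2) \<le> (\<Sum>j\<le>N. (cmod (fps_nth U j))\<^sup>2)"
  proof -
    have "(\<Sum>j\<le>N. (cmod (P j))\<^sup>2) = (\<Sum>j<N. (cmod (fps_nth U j))\<^sup>2)"
      by (simp add: P_def sum.atMost_shift)
    also have "\<dots> \<le> (\<Sum>j\<le>N. (cmod (fps_nth U j))\<^sup>2)"
      by (rule sum_mono2) auto
    finally show ?thesis .
  qed
  have "s\<^sup>2 * (\<Sum>j\<le>N. (cmod (fps_nth Q j))\<^sup>2) = (\<Sum>j\<le>N. (cmod (fps_nth U j - cnj w * P j))\<^sup>2)"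
    by (simp add: sum_distrib_left norm_mult power_mult_distrib flip: sQ)
  also have "\<dots> \<le> (\<Sum>j\<le>N. 2 * (cmod (fps_nth U j))\<^sup>2 + 2 * (cmod (P j))\<^sup>2)"
  proof (rule sum_mono)
    fix j
    have "(cmod (cnj w * P j))\<^sup>2 \<le> (cmod (P j))\<^sup>2"
      unfolding norm_mult using assms by (intro power_mono mult_left_le_one_le) auto
    then show "(cmod (fps_nth U j - cnj w * P j))\<^sup>2 \<le> 2 * (cmod (fps_nth U j))\<^sup>2 + 2 * (cmod (P j))\<^sup>2"
      using cmod_diff_squared_le [of "fps_nth U j" "cnj w * P j"] by linarith
  qed
  also have "\<dots> \<le> 4 * (\<Sum>j\<le>N. (cmod (fps_nth U j))\<^sup>2)"
    using P by (simp add: sum.distrib flip: sum_distrib_left)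
  also have "\<dots> \<le> 4 * (\<Sum>i<n. (cmod (c i))\<^sup>2)"
    unfolding U_def Q_def using weighted_composition_contractive [OF s2] by simp
  finally show ?thesis
    using s0 unfolding s2 [symmetric] Q_def [symmetric] by (simp add: field_simps)
qed


section \<open>Functions in the Hardy space and their Taylor coefficients\<close>

lemma disk_aut_in_disk:
  assumes "cmod w < 1" "cmod z < 1"
  shows "cmod (disk_aut w z) < 1"
  using Moebius_function_norm_lt_1 [OF assms, of 0]
  by (simp add: disk_aut_def Moebius_function_simple norm_divide norm_minus_commute)

lemma disk_aut_holomorphic:
  assumes "cmod w < 1"
  shows "disk_aut w holomorphic_on ball 0 1"
proof -
  have "disk_aut w = (\<lambda>z. - Moebius_function 0 w z)"
    by (simp add: fun_eq_iff disk_aut_def Moebius_function_simple minus_divide_left)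
  then show ?thesis
    using Moebius_function_holomorphic [OF assms] by (auto intro: holomorphic_intros)
qed

lemma one_minus_cnj_mult_nonzero:
  assumes "cmod w < 1" "cmod z < 1"
  shows "1 - cnj w * z \<noteq> 0"
proof -
  have "cmod (cnj w * z) < 1"
    using assms mult_strict_mono' [of "cmod w" 1 "cmod z" 1] by (simp add: norm_mult)
  then show ?thesis
    by auto
qed

lemma disk_aut_has_fps_expansion: "disk_aut w has_fps_expansion disk_aut_fps w"
proof -
  have inv: "szego_fps w = inverse (1 - fps_const (cnj w) * fps_X)"
    using szego_fps_inverse [of w] by (metis fps_inverse_unique)
  have "(\<lambda>z. (w - z) * inverse (1 - cnj w * z)) has_fps_expansion disk_aut_fps w"
    unfolding disk_aut_fps_def inv by (intro fps_expansion_intros) auto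
  then show ?thesis
    by (simp add: disk_aut_def [abs_def] divide_inverse)
qed

lemma hardyD:
  assumes "f \<in> hardy"
  shows "f holomorphic_on ball 0 1" "\<And>z. z \<notin> ball 0 1 \<Longrightarrow> f z = 0"
    "summable (\<lambda>n. (cmod (coef f n))\<^sup>2)" "f has_fps_expansion fps_expansion f 0"
  using assms has_fps_expansion_fps_expansion [of "ball 0 1" f]
  by (auto simp: hardy_def ell2_def)

lemma hardy_taylor_sums:
  assumes "f \<in> hardy" "cmod z < 1"
  shows "(\<lambda>n. coef f n * z ^ n) sums f z"
  using has_fps_expansion_imp_sums_complex [OF hardyD(4), of f 1 z] hardyD(1) assms
  by (simp add: one_ereal_def)

lemma hardy_eqI:
  assumes "f \<in> hardy" "g \<in> hardy" "\<And>n. coef f n = coef g n"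
  shows "f = g"
proof
  fix z
  show "f z = g z"
  proof (cases "cmod z < 1")
    case True
    then have "(\<lambda>n. coef f n * z ^ n) sums f z" "(\<lambda>n. coef f n * z ^ n) sums g z"
      using hardy_taylor_sums [of f z] hardy_taylor_sums [of g z] assms by auto
    then show ?thesis
      by (rule sums_unique2)
  qed (use hardyD(2) [OF assms(1)] hardyD(2) [OF assms(2)] in simp)
qed

lemma on_disk_holomorphic: "on_disk f holomorphic_on ball 0 1 \<longleftrightarrow> f holomorphic_on ball 0 1"
  by (rule holomorphic_cong) (auto simp: on_disk_def)

lemma coef_on_disk:
  assumes "f has_fps_expansion F"
  shows "coef (on_disk f) = fps_nth F"
proof -
  have "eventually (\<lambda>z. z \<in> ball 0 1) (nhds (0::complex))"
    by (rule eventually_nhds_in_open) auto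
  then have "eventually (\<lambda>z. on_disk f z = f z) (nhds 0)"
    by eventually_elim (simp add: on_disk_def)
  then have "fps_expansion (on_disk f) 0 = fps_expansion f 0"
    by (rule fps_expansion_cong)
  with fps_expansion_eqI [OF assms] show ?thesis
    by simp
qed

lemma hardy_with_coef:
  assumes "c \<in> ell2"
  obtains f where "f \<in> hardy" "coef f = c"
proof
  define f where "f = on_disk (\<lambda>z. \<Sum>n. c n * z ^ n)"
  have "(\<lambda>n. (cmod (c n))\<^sup>2) \<longlonglongrightarrow> 0"
    using assms unfolding ell2_def by (blast intro: summable_LIMSEQ_zero)
  then have "Bseq (\<lambda>n. (cmod (c n))\<^sup>2)"
    by (intro convergent_imp_Bseq convergentI)
  then obtain B where B: "B > 0" "\<And>n. (cmod (c n))\<^sup>2 \<le> B"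
    by (auto elim!: BseqE)
  have sums: "(\<lambda>n. c n * (z - 0) ^ n) sums f z" if "z \<in> ball 0 1" for z
  proof -
    have "summable (\<lambda>n. c n * z ^ n)"
    proof (rule summable_comparison_test')
      show "summable (\<lambda>n. sqrt B * cmod z ^ n)"
        using that by (intro summable_mult summable_geometric) auto
      show "cmod (c n * z ^ n) \<le> sqrt B * cmod z ^ n" for n
        using B(2)[of n] by (auto simp: norm_mult norm_power intro!: mult_right_mono real_le_rsqrt)
    qed
    with that show ?thesis
      by (simp add: f_def on_disk_def summable_sums)
  qed
  have holo: "f holomorphic_on ball 0 1"
    using sums by (rule power_series_holomorphic)
  have "eventually (\<lambda>z. z \<in> ball 0 1) (nhds (0::complex))"
    by (rule eventually_nhds_in_open) auto
  then have "f has_fps_expansion Abs_fps c"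
    by (intro has_fps_expansionI, eventually_elim) (use sums in simp)
  then show *: "coef f = c"
    by (metis fps_expansion_eqI fps_nth_Abs_fps fun_eq_iff)
  show "f \<in> hardy"
    using holo assms by (simp add: hardy_def *) (simp add: f_def on_disk_def)
qed

lemma hardy_diff:
  assumes "f \<in> hardy" "g \<in> hardy"
  shows "(\<lambda>z. f z - g z) \<in> hardy" "coef (\<lambda>z. f z - g z) n = coef f n - coef g n"
proof -
  have "(\<lambda>z. f z - g z) has_fps_expansion fps_expansion f 0 - fps_expansion g 0"
    by (intro fps_expansion_intros hardyD assms)
  then have *: "fps_expansion (\<lambda>z. f z - g z) 0 = fps_expansion f 0 - fps_expansion g 0"
    by (rule fps_expansion_eqI)
  show "coef (\<lambda>z. f z - g z) n = coef f n - coef g n"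
    by (simp add: *)
  have "summable (\<lambda>n. (cmod (coef f n - coef g n))\<^sup>2)"
  proof (rule summable_comparison_test')
    show "summable (\<lambda>n. 2 * (cmod (coef f n))\<^sup>2 + 2 * (cmod (coef g n))\<^sup>2)"
      by (intro summable_add summable_mult hardyD assms)
    show "norm ((cmod (coef f n - coef g n))\<^sup>2) \<le> 2 * (cmod (coef f n))\<^sup>2 + 2 * (cmod (coef g n))\<^sup>2" for n
      using cmod_diff_squared_le by simp
  qed
  then show "(\<lambda>z. f z - g z) \<in> hardy"
    using hardyD(1,2)[OF assms(1)] hardyD(1,2)[OF assms(2)]
    by (auto simp: hardy_def ell2_def * intro: holomorphic_intros)
qed

lemma zero_in_hardy: "(\<lambda>z. 0) \<in> hardy" "coef (\<lambda>z. 0) n = 0"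
proof -
  have "fps_expansion (\<lambda>z. 0::complex) 0 = 0"
    by (rule fps_expansion_eqI) simp
  then show "(\<lambda>z. 0) \<in> hardy" "coef (\<lambda>z. 0) n = 0"
    by (simp_all add: hardy_def ell2_def)
qed

lemma hardy_sum:
  assumes "\<And>i::nat. g i \<in> hardy"
  shows "(\<lambda>z. \<Sum>i<N. g i z) \<in> hardy" (is ?hardy)
    "coef (\<lambda>z. \<Sum>i<N. g i z) n = (\<Sum>i<N. coef (g i) n)" (is ?coef)
proof -
  have "?hardy \<and> ?coef"
  proof (induction N)
    case 0
    show ?case
      by (simp add: zero_in_hardy)
  next
    case (Suc N)
    \<comment> \<open>Addition is subtraction of a negative, so closure under differences suffices.\<close>
    define h where "h = (\<lambda>z. 0 - g N z)"
    have h: "h \<in> hardy" "coef h n = 0 - coef (g N) n" for n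
      using hardy_diff [OF zero_in_hardy(1) assms, of N] zero_in_hardy(2) by (simp_all add: h_def)
    show ?case
      using hardy_diff [OF conjunct1 [OF Suc] h(1)] Suc h(2) by (simp add: h_def)
  qed
  then show ?hardy ?coef
    by auto
qed

section \<open>Boundedness of the composition operator\<close>

text \<open>
  The Taylor polynomials of \<open>f\<close> converge uniformly on compact subsets of the disk, so, after composition
  with \<open>disk_aut w\<close>, each Taylor coefficient at the origin converges. The bound for polynomials
  is uniform in the degree, and a bound on finitely many coefficients survives the limit.
\<close>

lemma comp_op_hardy_bound:
  assumes "cmod w < 1" "f \<in> hardy"
  shows "comp_op w f holomorphic_on ball 0 1"
    "(\<Sum>j\<le>N. (cmod (coef (comp_op w f) j))\<^sup>2) \<le> 4 / (1 - (cmod w)\<^sup>2) * (\<Sum>n. (cmod (coef f n))\<^sup>2)"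
proof -
  define c where "c = coef f"
  have sub: "disk_aut w ` ball 0 1 \<subseteq> ball 0 1"
    using disk_aut_in_disk [OF assms(1)] by auto
  have holo: "f \<circ> disk_aut w holomorphic_on ball 0 1"
    by (rule holomorphic_on_compose_gen [OF disk_aut_holomorphic hardyD(1)]) (use assms sub in auto)
  then show "comp_op w f holomorphic_on ball 0 1"
    by (simp add: comp_op_def on_disk_holomorphic)
  define p where "p = (\<lambda>n z. \<Sum>i<n. c i * disk_aut w z ^ i)"
  have p_exp: "p n has_fps_expansion (\<Sum>i<n. fps_const (c i) * disk_aut_fps w ^ i)" for n
    unfolding p_def by (intro fps_expansion_intros disk_aut_has_fps_expansion)
  have p_holo: "p n holomorphic_on ball 0 (1/2)" for n
    unfolding p_def
    by (intro holomorphic_intros holomorphic_on_subset [OF disk_aut_holomorphic [OF assms(1)]]) auto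
  \<comment> \<open>Taylor coefficients depend only on the values near the origin, and \<open>disk_aut w\<close> maps the disk of radius \<open>1/2\<close> into a
    closed disk of radius \<open>norm y < 1\<close>.\<close>
  have "compact (disk_aut w ` cball 0 (1/2))"
    by (intro compact_continuous_image holomorphic_on_imp_continuous_on
        holomorphic_on_subset [OF disk_aut_holomorphic [OF assms(1)]]) auto
  then obtain y where y: "y \<in> disk_aut w ` cball 0 (1/2)"
      "\<And>z. z \<in> disk_aut w ` cball 0 (1/2) \<Longrightarrow> norm z \<le> norm y"
    using continuous_attains_sup [of _ norm]
    by (metis (no_types, lifting) centre_in_cball continuous_on_norm_id empty_iff
        image_is_empty zero_le_divide_1_iff zero_le_numeral)
  have y1: "norm y < 1"
    using y(1) disk_aut_in_disk [OF assms(1)] by auto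
  have "conv_radius c \<ge> 1"
    using conv_radius_fps_expansion [of f 0 1] hardyD(1)[OF assms(2)]
    by (simp add: c_def fps_conv_radius_def one_ereal_def)
  then have "ereal (norm y) < conv_radius c"
    using y1 by (metis less_le_trans ereal_less(3))
  then have "uniform_limit (cball 0 (norm y)) (\<lambda>n x. \<Sum>i<n. c i * (x - 0) ^ i)
      (\<lambda>x. \<Sum>i. c i * (x - 0) ^ i) sequentially"
    by (rule powser_uniform_limit)
  also have "?this \<longleftrightarrow> uniform_limit (cball 0 (norm y)) (\<lambda>n x. \<Sum>i<n. c i * x ^ i) f sequentially"
    using hardy_taylor_sums [OF assms(2)] y1
    by (intro uniform_limit_cong) (auto simp: c_def sums_iff)
  finally have "uniform_limit (ball 0 (1/2)) p (\<lambda>z. f (disk_aut w z)) sequentially"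
    unfolding p_def by (rule uniform_limit_compose') (use y(2) in auto)
  then have "(\<lambda>n. (deriv ^^ j) (p n) 0) \<longlonglongrightarrow> (deriv ^^ j) (\<lambda>z. f (disk_aut w z)) 0" for j
    by (rule higher_deriv_complex_uniform_limit) (use p_holo in auto)
  then have "(\<lambda>n. coef (p n) j) \<longlonglongrightarrow> coef (f \<circ> disk_aut w) j" for j
    unfolding fps_expansion_def o_def by (auto intro!: tendsto_intros)
  moreover have "coef (p n) = fps_nth (\<Sum>i<n. fps_const (c i) * disk_aut_fps w ^ i)" for n
    using fps_expansion_eqI [OF p_exp] by simp
  moreover have "coef (f \<circ> disk_aut w) = coef (comp_op w f)"
    using coef_on_disk [OF has_fps_expansion_fps_expansion [OF _ _ holo]] by (simp add: comp_op_def)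
  ultimately have lim: "(\<lambda>n. fps_nth (\<Sum>i<n. fps_const (c i) * disk_aut_fps w ^ i) j)
      \<longlonglongrightarrow> coef (comp_op w f) j" for j
    by simp
  have "(\<Sum>j\<le>N. (cmod (fps_nth (\<Sum>i<n. fps_const (c i) * disk_aut_fps w ^ i) j))\<^sup>2)
      \<le> 4 / (1 - (cmod w)\<^sup>2) * (\<Sum>n. (cmod (c n))\<^sup>2)" for n
  proof -
    have "(\<Sum>i<n. (cmod (c i))\<^sup>2) \<le> (\<Sum>n. (cmod (c n))\<^sup>2)"
      by (rule sum_le_suminf) (use hardyD(3)[OF assms(2)] in \<open>auto simp: c_def\<close>)
    moreover have "4 / (1 - (cmod w)\<^sup>2) \<ge> 0"
      using assms(1) by (simp add: power_le_one)
    ultimately show ?thesis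
      using polynomial_composition_bound [OF assms(1), where N = N and n = n and c = c]
      by (meson mult_left_mono order_trans)
  qed
  then show "(\<Sum>j\<le>N. (cmod (coef (comp_op w f) j))\<^sup>2)
      \<le> 4 / (1 - (cmod w)\<^sup>2) * (\<Sum>n. (cmod (coef f n))\<^sup>2)"
    unfolding c_def [symmetric]
    by (intro LIMSEQ_le_const2 [OF tendsto_sum [OF tendsto_power [OF tendsto_norm [OF lim]]]]) auto
qed

lemma comp_op_bounded:
  assumes "cmod w < 1" "f \<in> hardy"
  shows "comp_op w f \<in> hardy"
    "hardy_norm (comp_op w f) \<le> sqrt (4 / (1 - (cmod w)\<^sup>2)) * hardy_norm f"
proof -
  have sm: "summable (\<lambda>j. (cmod (coef (comp_op w f) j))\<^sup>2)"
    by (rule bounded_imp_summable [OF _ comp_op_hardy_bound(2)[OF assms]]) auto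
  then show "comp_op w f \<in> hardy"
    using comp_op_hardy_bound(1)[OF assms] by (simp add: hardy_def ell2_def) (simp add: comp_op_def on_disk_def)
  have "(\<Sum>j. (cmod (coef (comp_op w f) j))\<^sup>2) \<le> 4 / (1 - (cmod w)\<^sup>2) * (\<Sum>n. (cmod (coef f n))\<^sup>2)"
    using LIMSEQ_le_const2 [OF summable_LIMSEQ' [OF sm]] comp_op_hardy_bound(2)[OF assms] by blast
  then show "hardy_norm (comp_op w f) \<le> sqrt (4 / (1 - (cmod w)\<^sup>2)) * hardy_norm f"
    unfolding hardy_norm_def real_sqrt_mult [symmetric] by (rule real_sqrt_le_mono)
qed


section \<open>Series in the Hardy space\<close>

lemma coef_le_hardy_norm:
  assumes "f \<in> hardy"
  shows "cmod (coef f k) \<le> hardy_norm f"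
proof -
  have "(\<Sum>n\<in>{k}. (cmod (coef f n))\<^sup>2) \<le> (\<Sum>n. (cmod (coef f n))\<^sup>2)"
    by (rule sum_le_suminf) (use hardyD(3)[OF assms] in auto)
  then show ?thesis
    unfolding hardy_norm_def by (intro real_le_rsqrt) simp
qed

lemma hardy_sums_imp_coef_sums:
  assumes "hardy_sums g f"
  shows "(\<lambda>n. coef (g n) k) sums coef f k"
proof -
  have g: "g n \<in> hardy" and f: "f \<in> hardy"
    and lim: "(\<lambda>N. hardy_norm (\<lambda>z. f z - (\<Sum>n<N. g n z))) \<longlonglongrightarrow> 0" for n
    using assms by (auto simp: hardy_sums_def)
  have "cmod (coef f k - (\<Sum>n<N. coef (g n) k)) \<le> hardy_norm (\<lambda>z. f z - (\<Sum>n<N. g n z))" for N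
    using coef_le_hardy_norm [OF hardy_diff(1) [OF f hardy_sum(1) [where N = N, OF g]], where k = k]
    by (simp add: hardy_diff(2) [OF f hardy_sum(1) [OF g]] hardy_sum(2) [OF g])
  then have "(\<lambda>N. coef f k - (\<Sum>n<N. coef (g n) k)) \<longlonglongrightarrow> 0"
    by (intro Lim_null_comparison [OF _ lim] always_eventually allI)
  then show ?thesis
    unfolding sums_def using tendsto_diff [OF tendsto_const, of _ 0 sequentially "coef f k"] by fastforce
qed

lemma hardy_sums_unique:
  assumes "hardy_sums g f" "hardy_sums g f'"
  shows "f = f'"
proof (rule hardy_eqI)
  show "f \<in> hardy" "f' \<in> hardy"
    using assms by (auto simp: hardy_sums_def)
  show "coef f k = coef f' k" for k
    using assms by (intro sums_unique2 [OF hardy_sums_imp_coef_sums hardy_sums_imp_coef_sums])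
qed

lemma hardy_sums_comp_op:
  assumes "cmod w < 1" "hardy_sums g f"
  shows "hardy_sums (\<lambda>n. comp_op w (g n)) (comp_op w f)"
proof -
  have g: "g n \<in> hardy" and f: "f \<in> hardy"
    and lim: "(\<lambda>N. hardy_norm (\<lambda>z. f z - (\<Sum>n<N. g n z))) \<longlonglongrightarrow> 0" for n
    using assms(2) by (auto simp: hardy_sums_def)
  define B where "B = sqrt (4 / (1 - (cmod w)\<^sup>2))"
  have diff: "(\<lambda>z. f z - (\<Sum>n<N. g n z)) \<in> hardy" for N
    using hardy_diff(1) [OF f hardy_sum(1) [OF g]] .
  have eq: "(\<lambda>z. comp_op w f z - (\<Sum>n<N. comp_op w (g n) z)) =
      comp_op w (\<lambda>z. f z - (\<Sum>n<N. g n z))" for N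
    by (simp add: fun_eq_iff comp_op_def on_disk_def)
  have nonneg: "hardy_norm h \<ge> 0" if "h \<in> hardy" for h
    using coef_le_hardy_norm [OF that, of 0] by (meson norm_ge_zero order_trans)
  have "(\<lambda>N. B * hardy_norm (\<lambda>z. f z - (\<Sum>n<N. g n z))) \<longlonglongrightarrow> 0"
    using tendsto_mult_left [OF lim, of B] by simp
  then have "(\<lambda>N. hardy_norm (comp_op w (\<lambda>z. f z - (\<Sum>n<N. g n z)))) \<longlonglongrightarrow> 0"
  proof (rule tendsto_sandwich [OF _ _ tendsto_const, rotated 2])
    show "eventually (\<lambda>N. 0 \<le> hardy_norm (comp_op w (\<lambda>z. f z - (\<Sum>n<N. g n z)))) sequentially"
      using nonneg [OF comp_op_bounded(1) [OF assms(1) diff]] by simp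
    show "eventually (\<lambda>N. hardy_norm (comp_op w (\<lambda>z. f z - (\<Sum>n<N. g n z)))
        \<le> B * hardy_norm (\<lambda>z. f z - (\<Sum>n<N. g n z))) sequentially"
      using comp_op_bounded(2) [OF assms(1) diff] by (simp add: B_def)
  qed
  then show ?thesis
    unfolding hardy_sums_def eq using comp_op_bounded(1)[OF assms(1)] f g by blast
qed

text \<open>
  After the exponents outside the range of \<open>m\<close> have been dropped, the squared norm of the \<open>N\<close>-th
  remainder is a tail of the convergent series of the \<open>\<bar>coef F (m n)\<bar>\<^sup>2\<close>.
\<close>

lemma hardy_sums_monomials:
  fixes m :: "nat \<Rightarrow> nat"
  assumes m: "strict_mono m" and F: "F \<in> hardy" and zero: "\<And>k. k \<notin> range m \<Longrightarrow> coef F k = 0"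
  shows "hardy_sums (\<lambda>n. on_disk (\<lambda>z. coef F (m n) * z ^ m n)) F"
proof -
  define g where "g = (\<lambda>n. on_disk (\<lambda>z. coef F (m n) * z ^ m n))"
  have g_coef: "coef (g n) k = (if k = m n then coef F k else 0)" for n k
  proof -
    have "(\<lambda>z. coef F (m n) * z ^ m n) has_fps_expansion fps_const (coef F (m n)) * fps_X ^ m n"
      by (intro fps_expansion_intros)
    then show ?thesis
      unfolding g_def by (auto simp: coef_on_disk)
  qed
  have g: "g n \<in> hardy" for n
  proof -
    have "summable (\<lambda>k. (cmod (coef (g n) k))\<^sup>2)"
      by (rule summable_finite [of "{m n}"]) (auto simp: g_coef)
    moreover have "g n holomorphic_on ball 0 1"
      unfolding g_def on_disk_holomorphic by (intro holomorphic_intros)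
    ultimately show ?thesis
      by (simp add: hardy_def ell2_def) (simp add: g_def on_disk_def)
  qed
  define e where "e = (\<lambda>n. (cmod (coef F (m n)))\<^sup>2)"
  have e: "summable e"
    unfolding e_def using hardyD(3)[OF F] summable_mono_reindex [OF m, of "\<lambda>k. (cmod (coef F k))\<^sup>2"] zero
    by simp
  have norm: "hardy_norm (\<lambda>z. F z - (\<Sum>n<N. g n z)) = sqrt (suminf e - (\<Sum>n<N. e n))" for N
  proof -
    define d where "d = (\<lambda>z. F z - (\<Sum>n<N. g n z))"
    have d: "coef d k = coef F k - (\<Sum>n<N. if k = m n then coef F k else 0)" for k
      by (simp add: d_def hardy_diff(2) [OF F hardy_sum(1) [OF g]] hardy_sum(2) [OF g] g_coef)
    have "(cmod (coef d (m n)))\<^sup>2 = e n - (if n \<in> {..<N} then e n else 0)" for n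
      using strict_mono_eq [OF m] by (simp add: d e_def)
    moreover have "(\<lambda>n. e n - (if n \<in> {..<N} then e n else 0)) sums (suminf e - (\<Sum>n<N. e n))"
      by (intro sums_diff summable_sums e sums_If_finite_set) auto
    ultimately have "(\<lambda>n. (cmod (coef d (m n)))\<^sup>2) sums (suminf e - (\<Sum>n<N. e n))"
      by simp
    moreover have "(cmod (coef d k))\<^sup>2 = 0" if "k \<notin> range m" for k
      using zero [OF that] by (auto simp: d intro!: sum.neutral)
    ultimately have "(\<lambda>k. (cmod (coef d k))\<^sup>2) sums (suminf e - (\<Sum>n<N. e n))"
      using sums_mono_reindex [OF m, of "\<lambda>k. (cmod (coef d k))\<^sup>2"] by simp
    then show ?thesis
      by (simp add: hardy_norm_def d_def sums_iff)
  qed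
  have "(\<lambda>N. sqrt (suminf e - (\<Sum>n<N. e n))) \<longlonglongrightarrow> sqrt (suminf e - suminf e)"
    by (intro tendsto_intros summable_LIMSEQ e)
  then show ?thesis
    using F g unfolding hardy_sums_def norm [symmetric] g_def by simp
qed

definition supported_hardy :: "nat set \<Rightarrow> (complex \<Rightarrow> complex) set" where
  "supported_hardy A = {F \<in> hardy. \<forall>k. k \<notin> A \<longrightarrow> coef F k = 0}"

lemma comp_op_monomial:
  assumes "cmod w < 1"
  shows "comp_op w (on_disk (\<lambda>z. c * z ^ k)) = on_disk (\<lambda>z. c * disk_aut w z ^ k)"
  using disk_aut_in_disk [OF assms] by (simp add: fun_eq_iff comp_op_def on_disk_def)

lemma supported_hardy_sums:
  assumes w: "cmod w < 1" and m: "strict_mono m" and F: "F \<in> supported_hardy (range m)"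
  shows "hardy_sums (\<lambda>n. on_disk (\<lambda>z. coef F (m n) * disk_aut w z ^ m n)) (comp_op w F)"
  using hardy_sums_comp_op [OF w hardy_sums_monomials [OF m, of F]] F
  by (simp add: comp_op_monomial [OF w] supported_hardy_def)

lemma supported_hardy_with_coef:
  fixes m :: "nat \<Rightarrow> nat"
  assumes m: "strict_mono m" and \<alpha>: "\<alpha> \<in> ell2"
  obtains F where "F \<in> supported_hardy (range m)" "\<And>n. coef F (m n) = \<alpha> n"
proof -
  define c where "c = (\<lambda>k. if k \<in> range m then \<alpha> (inv m k) else 0)"
  have c: "c (m n) = \<alpha> n" for n
    by (simp add: c_def inv_f_f [OF strict_mono_imp_inj_on [OF m]])
  have "summable (\<lambda>k. (cmod (c k))\<^sup>2)"
    using summable_mono_reindex [OF m, of "\<lambda>k. (cmod (c k))\<^sup>2"] \<alpha> by (simp add: c ell2_def) (simp add: c_def)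
  then obtain F where F: "F \<in> hardy" "coef F = c"
    using hardy_with_coef [of c] by (auto simp: ell2_def)
  show thesis
    by (rule that [of F]) (use F c in \<open>auto simp: supported_hardy_def c_def\<close>)
qed

text \<open>
  Every square-summable \<open>\<alpha>\<close> comes from a function \<open>F\<close> with coefficients \<open>\<alpha> n\<close> at \<open>m n\<close>, and
  \<open>comp_op w\<close> maps the Taylor series of \<open>F\<close> term by term to the series in powers of \<open>disk_aut w\<close>.
  Uniqueness of sums then identifies the sum with \<open>comp_op w F\<close>.
\<close>

lemma series_space_eq_comp_op_image:
  fixes m :: "nat \<Rightarrow> nat"
  assumes w: "cmod w < 1" and m: "strict_mono m"
  shows "{f. \<exists>\<alpha>\<in>ell2. hardy_sums (\<lambda>n. on_disk (\<lambda>z. \<alpha> n * disk_aut w z ^ m n)) f} =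
         comp_op w ` supported_hardy (range m)" (is "?L = ?R")
proof
  show "?L \<subseteq> ?R"
  proof clarify
    fix f \<alpha>
    assume \<alpha>: "\<alpha> \<in> ell2" and f: "hardy_sums (\<lambda>n. on_disk (\<lambda>z. \<alpha> n * disk_aut w z ^ m n)) f"
    obtain F where F: "F \<in> supported_hardy (range m)" "\<And>n. coef F (m n) = \<alpha> n"
      using supported_hardy_with_coef [OF m \<alpha>] by metis
    then have "f = comp_op w F"
      using hardy_sums_unique [OF f] supported_hardy_sums [OF w m F(1)] by simp
    with F(1) show "f \<in> ?R"
      by blast
  qed
  show "?R \<subseteq> ?L"
  proof clarify
    fix F assume F: "F \<in> supported_hardy (range m)"
    then have "(\<lambda>n. coef F (m n)) \<in> ell2"
      using summable_mono_reindex [OF m, of "\<lambda>k. (cmod (coef F k))\<^sup>2"] hardyD(3) [of F]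
      by (simp add: supported_hardy_def ell2_def)
    then show "\<exists>\<alpha>\<in>ell2. hardy_sums (\<lambda>n. on_disk (\<lambda>z. \<alpha> n * disk_aut w z ^ m n)) (comp_op w F)"
      using supported_hardy_sums [OF w m F] by (intro bexI [where x = "\<lambda>n. coef F (m n)"])
  qed
qed

section \<open>Even and odd functions\<close>

lemma hardy_parity_iff:
  assumes F: "F \<in> hardy"
  shows "(\<forall>z\<in>ball 0 1. F (- z) = \<epsilon> * F z) \<longleftrightarrow> (\<forall>k. coef F k * (-1) ^ k = \<epsilon> * coef F k)"
proof
  have refl_sums: "(\<lambda>k. coef F k * (-1) ^ k * z ^ k) sums F (- z)" if "z \<in> ball 0 1" for z
    using hardy_taylor_sums [OF F, of "- z"] that by (simp add: mult.assoc flip: power_mult_distrib)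
  {
    assume eq: "\<forall>z\<in>ball 0 1. F (- z) = \<epsilon> * F z"
    have "eventually (\<lambda>z. z \<in> ball 0 1) (nhds (0::complex))"
      by (rule eventually_nhds_in_open) auto
    then have "(\<lambda>z. \<epsilon> * F z) has_fps_expansion Abs_fps (\<lambda>k. coef F k * (-1) ^ k)"
      by (intro has_fps_expansionI, eventually_elim) (use refl_sums eq in simp)
    moreover have "(\<lambda>z. \<epsilon> * F z) has_fps_expansion fps_const \<epsilon> * fps_expansion F 0"
      by (intro fps_expansion_intros hardyD F)
    ultimately have "Abs_fps (\<lambda>k. coef F k * (-1) ^ k) = fps_const \<epsilon> * fps_expansion F 0"
      by (metis fps_expansion_eqI)
    then show "\<forall>k. coef F k * (-1) ^ k = \<epsilon> * coef F k"
      by (metis fps_mult_left_const_nth fps_nth_Abs_fps)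
  }
  {
    assume eq: "\<forall>k. coef F k * (-1) ^ k = \<epsilon> * coef F k"
    show "\<forall>z\<in>ball 0 1. F (- z) = \<epsilon> * F z"
    proof
      fix z :: complex assume z: "z \<in> ball 0 1"
      have "(\<lambda>k. \<epsilon> * (coef F k * z ^ k)) sums (\<epsilon> * F z)"
        using z by (intro sums_mult hardy_taylor_sums F) auto
      then show "F (- z) = \<epsilon> * F z"
        using refl_sums [OF z] eq by (metis (no_types, lifting) mult.assoc sums_cong sums_unique2)
    qed
  }
qed

lemma even_hardy_eq: "even_hardy = supported_hardy (range (\<lambda>n. 2 * n))"
proof -
  have "(\<forall>k. coef F k * (-1) ^ k = 1 * coef F k) \<longleftrightarrow> (\<forall>k. k \<notin> range (\<lambda>n. 2 * n) \<longrightarrow> coef F k = 0)" for F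
  proof -
    have "coef F k * (-1) ^ k = 1 * coef F k \<longleftrightarrow> (k \<notin> range (\<lambda>n. 2 * n) \<longrightarrow> coef F k = 0)" for k
      by (cases "even k") (auto elim!: evenE)
    then show ?thesis
      by blast
  qed
  then show ?thesis
    unfolding even_hardy_def supported_hardy_def using hardy_parity_iff [of _ 1]
    by (intro Collect_cong conj_cong refl) simp
qed

lemma odd_hardy_eq: "odd_hardy = supported_hardy (range (\<lambda>n. 2 * n + 1))"
proof -
  have "(\<forall>k. coef F k * (-1) ^ k = -1 * coef F k) \<longleftrightarrow> (\<forall>k. k \<notin> range (\<lambda>n. 2 * n + 1) \<longrightarrow> coef F k = 0)" for F
  proof -
    have "coef F k * (-1) ^ k = -1 * coef F k \<longleftrightarrow> (k \<notin> range (\<lambda>n. 2 * n + 1) \<longrightarrow> coef F k = 0)" for k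
      by (cases "even k") (auto elim!: oddE)
    then show ?thesis
      by blast
  qed
  then show ?thesis
    unfolding odd_hardy_def supported_hardy_def using hardy_parity_iff [of _ "-1"]
    by (intro Collect_cong conj_cong refl) simp
qed

section \<open>Eigenfunctions and parity\<close>

lemma disk_aut_involution:
  assumes "cmod w < 1" "cmod z < 1"
  shows "disk_aut w (disk_aut w z) = z"
proof -
  have nz: "1 - cnj w * z \<noteq> 0" "1 - cnj w * w \<noteq> 0"
    using one_minus_cnj_mult_nonzero assms by auto
  have "w - disk_aut w z = z * (1 - cnj w * w) / (1 - cnj w * z)"
    "1 - cnj w * disk_aut w z = (1 - cnj w * w) / (1 - cnj w * z)"
    using nz by (simp_all add: disk_aut_def divide_simps) (simp_all add: algebra_simps)
  then show ?thesis
    using nz by (simp add: disk_aut_def [of w "disk_aut w z"])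
qed

text \<open>
  This is a computation once \<open>a\<close> is expressed by its fixed point \<open>w\<close>, as \<open>a * (1 + \<bar>w\<bar>\<^sup>2) = 2 * w\<close>: with that
  substitution \<open>w - disk_aut a z\<close> and \<open>1 - cnj w * disk_aut a z\<close> become multiples, with the same factor,
  of \<open>- (w - z)\<close> and \<open>1 - cnj w * z\<close>.
\<close>

lemma disk_aut_fix_pt_conjugation:
  assumes a: "cmod a < 1" and z: "cmod z < 1"
  shows "disk_aut (fix_pt a) (disk_aut a z) = - disk_aut (fix_pt a) z"
proof -
  define w where "w = fix_pt a"
  have w1: "cmod w < 1" and fixed: "disk_aut a w = w"
    using fix_pt_unique_fixed_point [OF a, of w] by (auto simp: w_def)
  have q: "cnj a * w\<^sup>2 - 2 * w + a = 0"
    using fixed disk_aut_fixed_iff [OF a w1] by simp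
  then have q': "a * (cnj w)\<^sup>2 - 2 * cnj w + cnj a = 0"
  proof -
    have "a * (cnj w)\<^sup>2 - 2 * cnj w + cnj a = cnj (cnj a * w\<^sup>2 - 2 * w + a)"
      by simp
    then show ?thesis
      unfolding q by simp
  qed
  have nz: "1 - cnj w * w \<noteq> 0" "1 - cnj a * z \<noteq> 0" "1 - cnj w * z \<noteq> 0"
    using one_minus_cnj_mult_nonzero a z w1 by auto
  \<comment> \<open>Eliminating \<open>cnj a\<close> between the fixed point equation and its conjugate determines \<open>a\<close>.\<close>
  have "(1 - cnj w * w) * (a * (1 + cnj w * w) - 2 * w) = 0"
    using q q' by algebra
  then have aw: "a * (1 + cnj w * w) = 2 * w"
    using nz by simp
  then have aw': "cnj a * (1 + cnj w * w) = 2 * cnj w"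
  proof -
    have "cnj a * (1 + cnj w * w) = cnj (a * (1 + cnj w * w))"
      by (simp add: mult.commute)
    then show ?thesis
      unfolding aw by simp
  qed
  have "cmod (cnj w * w) < 1"
    using w1 mult_strict_mono' [of "cmod w" 1 "cmod w" 1] by (simp add: norm_mult)
  then have "1 + cnj w * w \<noteq> 0"
    by (metis add.inverse_inverse add_eq_0_iff less_irrefl norm_minus_cancel norm_one)
  moreover have "(1 + cnj w * w) * ((w - disk_aut a z) * (1 - cnj w * z)) =
      (1 + cnj w * w) * (- (w - z) * (1 - cnj w * disk_aut a z))"
  proof -
    define v where "v = disk_aut a z"
    have v: "v * (1 - cnj a * z) = a - z"
      using nz by (simp add: v_def disk_aut_def)
    have "(1 - cnj a * z) * ((1 + cnj w * w) * ((w - v) * (1 - cnj w * z))) =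
        (1 - cnj a * z) * ((1 + cnj w * w) * (- (w - z) * (1 - cnj w * v)))"
      using v aw aw' by algebra
    then show ?thesis
      using nz by (simp add: v_def)
  qed
  ultimately have "(w - disk_aut a z) * (1 - cnj w * z) = - (w - z) * (1 - cnj w * disk_aut a z)"
    by simp
  moreover have "1 - cnj w * disk_aut a z \<noteq> 0"
    using one_minus_cnj_mult_nonzero w1 disk_aut_in_disk [OF a z] by blast
  ultimately show ?thesis
    using nz unfolding w_def [symmetric] disk_aut_def [of w] minus_divide_left
    by (simp add: frac_eq_eq)
qed

lemma comp_op_involution:
  assumes "cmod w < 1" "f \<in> hardy"
  shows "comp_op w (comp_op w f) = f"
  using disk_aut_in_disk [OF assms(1)] disk_aut_involution [OF assms(1)] hardyD(2)[OF assms(2)]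
  by (auto simp: fun_eq_iff comp_op_def on_disk_def)

text \<open>
  Substitute \<open>disk_aut w z\<close> for the variable, where \<open>w = fix_pt a\<close>: by the conjugation,
  \<open>disk_aut a (disk_aut w z) = disk_aut w (- z)\<close>.
\<close>

lemma eigenfunction_iff_parity:
  assumes a: "cmod a < 1"
  shows "(\<forall>z\<in>ball 0 1. f (disk_aut a z) = \<epsilon> * f z) \<longleftrightarrow>
         (\<forall>z\<in>ball 0 1. comp_op (fix_pt a) f (- z) = \<epsilon> * comp_op (fix_pt a) f z)"
proof -
  define w where "w = fix_pt a"
  have w: "cmod w < 1"
    using fix_pt_unique_fixed_point [OF a, of w] by (auto simp: w_def)
  have conj: "disk_aut a (disk_aut w z) = disk_aut w (- z)" if "cmod z < 1" for z
    using disk_aut_fix_pt_conjugation [OF a disk_aut_in_disk [OF w that]] that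
      disk_aut_involution [OF w] disk_aut_in_disk [OF w] disk_aut_in_disk [OF a]
    unfolding w_def [symmetric] by metis
  have "(\<forall>z\<in>ball 0 1. f (disk_aut a z) = \<epsilon> * f z) \<longleftrightarrow>
      (\<forall>z\<in>ball 0 1. f (disk_aut a (disk_aut w z)) = \<epsilon> * f (disk_aut w z))"
    using disk_aut_involution [OF w] disk_aut_in_disk [OF w] by (metis mem_ball_0)
  also have "\<dots> \<longleftrightarrow> (\<forall>z\<in>ball 0 1. comp_op w f (- z) = \<epsilon> * comp_op w f z)"
    by (rule ball_cong) (auto simp: conj comp_op_def on_disk_def)
  finally show ?thesis
    by (simp add: w_def)
qed

lemma eigenspace_eq_comp_op_image:
  assumes a: "cmod a < 1"
  shows "{f \<in> hardy. \<forall>z\<in>ball 0 1. f (disk_aut a z) = \<epsilon> * f z} =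
         comp_op (fix_pt a) ` {F \<in> hardy. \<forall>z\<in>ball 0 1. F (- z) = \<epsilon> * F z}"
    (is "?L = _ ` ?R")
proof -
  define w where "w = fix_pt a"
  have w: "cmod w < 1"
    using fix_pt_unique_fixed_point [OF a, of w] by (auto simp: w_def)
  have iff: "comp_op w f \<in> ?R \<longleftrightarrow> f \<in> ?L" if "f \<in> hardy" for f
    unfolding mem_Collect_eq eigenfunction_iff_parity [OF a] w_def [symmetric]
    using that comp_op_bounded(1) [OF w that] by blast
  show ?thesis
    unfolding w_def [symmetric]
  proof (intro equalityI subsetI)
    fix f assume f: "f \<in> ?L"
    then have h: "f \<in> hardy"
      by blast
    show "f \<in> comp_op w ` ?R"
      using comp_op_involution [OF w h] iff [OF h] f by (intro image_eqI [where x = "comp_op w f"]) auto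
  next
    fix f assume "f \<in> comp_op w ` ?R"
    then obtain F where F: "F \<in> ?R" "f = comp_op w F"
      by blast
    then have "F \<in> hardy"
      by blast
    then have "f \<in> hardy" "comp_op w f = F"
      unfolding F(2) using comp_op_bounded(1) [OF w] comp_op_involution [OF w] by auto
    then show "f \<in> ?L"
      using iff F(1) by blast
  qed
qed

lemma nullspace_minus_eq:
  assumes "cmod a < 1"
  shows "nullspace (\<lambda>f z. comp_op a f z - f z) = comp_op (fix_pt a) ` even_hardy"
proof -
  have "(\<lambda>z. comp_op a f z - f z) = (\<lambda>z. 0) \<longleftrightarrow> (\<forall>z\<in>ball 0 1. f (disk_aut a z) = 1 * f z)"
    if "f \<in> hardy" for f
    using hardyD(2)[OF that] by (auto simp: fun_eq_iff comp_op_def on_disk_def)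
  then have "nullspace (\<lambda>f z. comp_op a f z - f z) =
      {f \<in> hardy. \<forall>z\<in>ball 0 1. f (disk_aut a z) = 1 * f z}"
    unfolding nullspace_def by (intro Collect_cong conj_cong refl)
  then show ?thesis
    unfolding eigenspace_eq_comp_op_image [OF assms] by (simp add: even_hardy_def)
qed

lemma nullspace_plus_eq:
  assumes "cmod a < 1"
  shows "nullspace (\<lambda>f z. comp_op a f z + f z) = comp_op (fix_pt a) ` odd_hardy"
proof -
  have "(\<lambda>z. comp_op a f z + f z) = (\<lambda>z. 0) \<longleftrightarrow> (\<forall>z\<in>ball 0 1. f (disk_aut a z) = -1 * f z)"
    if "f \<in> hardy" for f
    using hardyD(2)[OF that] by (auto simp: fun_eq_iff comp_op_def on_disk_def add_eq_0_iff2)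
  then have "nullspace (\<lambda>f z. comp_op a f z + f z) =
      {f \<in> hardy. \<forall>z\<in>ball 0 1. f (disk_aut a z) = -1 * f z}"
    unfolding nullspace_def by (intro Collect_cong conj_cong refl)
  then show ?thesis
    unfolding eigenspace_eq_comp_op_image [OF assms] by (simp add: odd_hardy_def)
qed

theorem theorem5p1:
  fixes a :: complex
  assumes "a \<in> ball 0 1"
  shows
    "(\<forall>\<alpha>\<in>ell2. \<exists>f. hardy_sums (\<lambda>n. on_disk (\<lambda>z. \<alpha> n * disk_aut (fix_pt a) z ^ (2 * n))) f) \<and>
     (\<forall>\<alpha>\<in>ell2. \<exists>g. hardy_sums (\<lambda>n. on_disk (\<lambda>z. \<alpha> n * disk_aut (fix_pt a) z ^ (2 * n + 1))) g) \<and>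
     nullspace (\<lambda>f z. comp_op a f z - f z) =
       {f. \<exists>\<alpha>\<in>ell2. hardy_sums (\<lambda>n. on_disk (\<lambda>z. \<alpha> n * disk_aut (fix_pt a) z ^ (2 * n))) f} \<and>
     {f. \<exists>\<alpha>\<in>ell2. hardy_sums (\<lambda>n. on_disk (\<lambda>z. \<alpha> n * disk_aut (fix_pt a) z ^ (2 * n))) f} =
       comp_op (fix_pt a) ` even_hardy \<and>
     nullspace (\<lambda>f z. comp_op a f z + f z) =
       {g. \<exists>\<alpha>\<in>ell2. hardy_sums (\<lambda>n. on_disk (\<lambda>z. \<alpha> n * disk_aut (fix_pt a) z ^ (2 * n + 1))) g} \<and>
     {g. \<exists>\<alpha>\<in>ell2. hardy_sums (\<lambda>n. on_disk (\<lambda>z. \<alpha> n * disk_aut (fix_pt a) z ^ (2 * n + 1))) g} =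
       comp_op (fix_pt a) ` odd_hardy"
proof -
  have a: "cmod a < 1"
    using assms by simp
  have w: "cmod (fix_pt a) < 1"
    using fix_pt_unique_fixed_point [OF a, of "fix_pt a"] by simp
  have mono: "strict_mono (\<lambda>n::nat. 2 * n)" "strict_mono (\<lambda>n::nat. 2 * n + 1)"
    by (auto intro: strict_monoI)
  have ex: "\<exists>f. hardy_sums (\<lambda>n. on_disk (\<lambda>z. \<alpha> n * disk_aut (fix_pt a) z ^ m n)) f"
    if \<alpha>: "\<alpha> \<in> ell2" and m: "strict_mono m" for \<alpha> and m :: "nat \<Rightarrow> nat"
  proof -
    obtain F where F: "F \<in> supported_hardy (range m)" "\<And>n. coef F (m n) = \<alpha> n"
      using supported_hardy_with_coef [OF m \<alpha>] by metis
    then show ?thesis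
      using supported_hardy_sums [OF w m F(1)] by auto
  qed
  show ?thesis
    using ex [OF _ mono(1)] ex [OF _ mono(2)] nullspace_minus_eq [OF a] nullspace_plus_eq [OF a]
      series_space_eq_comp_op_image [OF w mono(1)] series_space_eq_comp_op_image [OF w mono(2)]
    unfolding even_hardy_eq odd_hardy_eq by simp
qed

end
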